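(* Let $\alpha\in\mathbb{R}$ and let $(v,f,p)$ be a $C^1$-solution with parameter $\alpha$ such that $f=0$ identically and $V\not\equiv0$. Then $\alpha\le-1$ and, up to a rotation of $\mathbb{R}^3$, the solution is given by $$V=\frac{A}{r^{\alpha+1}}\,\langle -y,x,0\rangle,\qquad P=-\frac{A^2}{2\alpha\, r^{2\alpha}},\qquad r=\sqrt{x^2+y^2},$$ for some constant $A\in\mathbb{R}$. In particular, there are no nontrivial $C^1$-solutions with $f=0$ for $\alpha>-1$.
   Context: $\mathbb{S}^2$ is the unit sphere in $\mathbb{R}^3$ with outward unit normal $\vec n$; $(x,y,z)$ are Cartesian coordinates in $\mathbb{R}^3$. A $C^k$-solution with parameter $\alpha$ is a triple $(v,f,p)$, where $v$ is a tangent vector field and $f,p$ are functions on $\mathbb{S}^2$, all of class $C^k$ ($k\ge1$), such that $$V(X)=\frac{v+f\vec n}{|X|^{\alpha}},\qquad P(X)=\frac{p}{|X|^{2\alpha}}$$ ($v,f,p,\vec n$ evaluated at $X/|X|$) solve $V\cdot\nabla V+\nabla P=0$, $\operatorname{div}V=0$ in $\mathbb{R}^3\setminus\{0\}$. Equivalently, on $\mathbb{S}^2$, $$(2-\alpha)f+\operatorname{div}v=0,\quad v\nabla f=|v|^2+\alpha f^2+2\alpha p,\quad (1-\alpha)fv+v\nabla v=-\nabla p,$$ where $v\nabla f=\langle v,\nabla f\rangle$ and $v\nabla v$ is the covariant derivative. *)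

theory Defs
  imports "HOL-Analysis.Analysis"
begin

definition C1_on_open :: "'a::real_normed_vector set \<Rightarrow> ('a \<Rightarrow> 'b::real_normed_vector) \<Rightarrow> bool"
  where "C1_on_open U g \<longleftrightarrow> open U \<and>
    (\<exists>g' :: 'a \<Rightarrow> 'a \<Rightarrow>\<^sub>L 'b.
       (\<forall>x\<in>U. (g has_derivative blinfun_apply (g' x)) (at x)) \<and> continuous_on U g')"

text \<open>The class \<open>C\<^sup>1\<close> on an embedded submanifold such as the sphere: near each point of \<open>S\<close>,
  \<open>f\<close> is the restriction of a \<open>C\<^sup>1\<close> map defined on an open set of the ambient space.
  The values of \<open>f\<close> outside \<open>S\<close> play no role.\<close>

definition C1_on_submanifold :: "'a::real_normed_vector set \<Rightarrow> ('a \<Rightarrow> 'b::real_normed_vector) \<Rightarrow> bool"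
  where "C1_on_submanifold S f \<longleftrightarrow>
    (\<forall>x\<in>S. \<exists>U g. x \<in> U \<and> C1_on_open U g \<and> (\<forall>y\<in>U \<inter> S. g y = f y))"

text \<open>\<open>(V \<cdot> \<nabla>) V\<close> is the derivative of \<open>V\<close> in the direction \<open>V\<close>, that is, the Jacobian matrix applied
  to \<open>V\<close>, and the divergence is the trace of the Jacobian matrix.\<close>

definition stationary_euler_on ::
    "(real^'n::finite) set \<Rightarrow> (real^'n \<Rightarrow> real^'n) \<Rightarrow> (real^'n \<Rightarrow> real) \<Rightarrow> bool"
  where "stationary_euler_on S V P \<longleftrightarrow>
    (\<forall>X\<in>S. V differentiable (at X) \<and>
       (\<exists>g. GDERIV P X :> g \<and> jacobian V (at X) *v V X + g = 0) \<and>
       trace (jacobian V (at X)) = 0)"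

text \<open>The outward unit normal of the sphere at \<open>X / |X|\<close> is \<open>X / |X|\<close> itself, written \<open>sgn X\<close>.\<close>

definition homogeneous_velocity ::
    "real \<Rightarrow> (real^3 \<Rightarrow> real^3) \<Rightarrow> (real^3 \<Rightarrow> real) \<Rightarrow> real^3 \<Rightarrow> real^3"
  where "homogeneous_velocity \<alpha> v f X =
    (v (sgn X) + f (sgn X) *\<^sub>R sgn X) /\<^sub>R (norm X powr \<alpha>)"

definition homogeneous_pressure :: "real \<Rightarrow> (real^3 \<Rightarrow> real) \<Rightarrow> real^3 \<Rightarrow> real"
  where "homogeneous_pressure \<alpha> p X = p (sgn X) / norm X powr (2 * \<alpha>)"

definition C1_solution ::
    "real \<Rightarrow> (real^3 \<Rightarrow> real^3) \<Rightarrow> (real^3 \<Rightarrow> real) \<Rightarrow> (real^3 \<Rightarrow> real) \<Rightarrow> bool"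
  where "C1_solution \<alpha> v f p \<longleftrightarrow>
    (\<forall>x\<in>sphere 0 1. v x \<bullet> x = 0) \<and>
    C1_on_submanifold (sphere 0 1) v \<and>
    C1_on_submanifold (sphere 0 1) f \<and>
    C1_on_submanifold (sphere 0 1) p \<and>
    stationary_euler_on (UNIV - {0}) (homogeneous_velocity \<alpha> v f) (homogeneous_pressure \<alpha> p)"

definition cyl_radius :: "real^3 \<Rightarrow> real"
  where "cyl_radius X = sqrt ((X$1)\<^sup>2 + (X$2)\<^sup>2)"

text \<open>On the axis \<open>r = 0\<close> the conventions \<open>0 powr a = 0\<close> and \<open>x / 0 = 0\<close> make both expressions
  below vanish; for \<open>\<alpha> \<le> -1\<close> this agrees with their continuous extension to the axis.\<close>

definition axial_velocity :: "real \<Rightarrow> real \<Rightarrow> real^3 \<Rightarrow> real^3"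
  where "axial_velocity \<alpha> A X =
    (A / cyl_radius X powr (\<alpha> + 1)) *\<^sub>R vector [- (X$2), X$1, 0]"

definition axial_pressure :: "real \<Rightarrow> real \<Rightarrow> real^3 \<Rightarrow> real"
  where "axial_pressure \<alpha> A X = - (A\<^sup>2 / (2 * \<alpha> * cyl_radius X powr (2 * \<alpha>)))"

end

(* With f = 0 the field V is tangent to spheres and homogeneous of degree -alpha, and the radial
   component of the Euler equation gives P = -|V|^2 / (2 alpha). Hence V . grad V is a multiple of
   grad |V|^2, and for alpha \<noteq> 1 |V| is constant along trajectories. Together with div V = 0 this
   says exactly that the Jacobian of Y = |V|^(-1/alpha - 1) V is skew wherever V \<noteq> 0. A field with
   skew derivative is an infinitesimal rigid motion, and since Y is homogeneous of degree 1 it is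
   E \<times> X for a constant vector E, first locally and then, by connectedness, off the axis of E.
   So V = |E \<times> X|^(-alpha - 1) E \<times> X, which is differentiable on the axis only if alpha \<le> -1.

   For alpha = 1 the field is irrotational where it does not vanish. In stereographic coordinates it
   is a function that is holomorphic off its zeros and tends to 0 at infinity, hence zero by the
   maximum modulus principle. For alpha = 0 the pressure relation forces V = 0. *)

theory Submission
  imports Defs "HOL-Complex_Analysis.Conformal_Mappings"
begin

unbundle cross3_syntax
unbundle no Formal_Power_Series.fps_syntax

subsection \<open>Linear algebra in three dimensions\<close>

lemma inner_mv_sum: "(x::real^3) \<bullet> (M *v y) = (\<Sum>i\<in>UNIV. \<Sum>j\<in>UNIV. M$i$j * (x$i * y$j))"
  by (simp add: inner_vec_def matrix_vector_mult_def sum_distrib_left mult_ac)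

text \<open>The Gram matrix of \<open>x, v\<close> is inverted explicitly, so that no orthogonality is needed.\<close>

lemma trace_frame:
  fixes M :: "real^3^3" and x v :: "real^3"
  shows "((x \<bullet> x) * (v \<bullet> v) - (x \<bullet> v)\<^sup>2) * trace M =
    (v \<bullet> v) * (x \<bullet> (M *v x)) + (x \<bullet> x) * (v \<bullet> (M *v v))
    - (x \<bullet> v) * (x \<bullet> (M *v v) + v \<bullet> (M *v x)) + (x \<times> v) \<bullet> (M *v (x \<times> v))"
  unfolding inner_mv_sum
  by (simp add: trace_def sum_3 cross_components inner_vec_def) algebra

lemma frame_expansion:
  fixes n x v :: "real^3"
  assumes "x \<bullet> v = 0"
  shows "((x \<bullet> x) * (v \<bullet> v)) *\<^sub>R n =
    ((v \<bullet> v) * (n \<bullet> x)) *\<^sub>R x + ((x \<bullet> x) * (n \<bullet> v)) *\<^sub>R v + (n \<bullet> (x \<times> v)) *\<^sub>R (x \<times> v)"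
proof -
  \<comment> \<open>With the mixed terms of the inverse Gram matrix kept, the expansion is a
    polynomial identity in the coordinates; orthogonality is inserted only afterwards.\<close>
  have "((x \<bullet> x) * (v \<bullet> v) - (x \<bullet> v)\<^sup>2) *\<^sub>R n =
    ((v \<bullet> v) * (n \<bullet> x)- (x \<bullet> v) * (n \<bullet> v)) *\<^sub>R x + ((x \<bullet> x) * (n \<bullet> v) - (x \<bullet> v) * (n \<bullet> x)) *\<^sub>R v
     + (n \<bullet> (x \<times> v)) *\<^sub>R (x \<times> v)"
    unfolding vec_eq_iff forall_3
    by (simp add: cross_components inner_vec_def sum_3, intro conjI; algebra)
  then show ?thesis using assms by simp
qed

text \<open>In the orthogonal frame \<open>x, v, x \<times> v\<close> the hypotheses determine all coefficients of the
  quadratic form of \<open>M\<close>: the two diagonal ones along \<open>v\<close> and \<open>x \<times> v\<close> vanish (the latter by the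
  trace), and the mixed ones are tied together by the last hypothesis.\<close>

lemma quadratic_form_of_gradient:
  fixes M :: "real^3^3" and x v n :: "real^3"
  assumes xv: "x \<bullet> v = 0" and x: "x \<noteq> 0" and v: "v \<noteq> 0"
    and Mx: "M *v x = (-\<alpha>) *\<^sub>R v"
    and xM: "\<And>h. x \<bullet> (M *v h) = - (v \<bullet> h)"
    and tr: "trace M = 0"
    and Mv: "\<And>h. \<alpha> * ((M *v v) \<bullet> h) = v \<bullet> (M *v h)"
    and a1: "\<alpha> \<noteq> 1"
  shows "(v \<bullet> v) * (n \<bullet> (M *v n)) = (1 + \<alpha>) * (v \<bullet> n) * ((M *v v) \<bullet> n)"
proof -
  define w where "w = x \<times> v"
  define D where "D = (x \<bullet> x) * (v \<bullet> v)"
  have D: "D \<noteq> 0" using x v by (simp add: D_def)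
  \<comment> \<open>Taking \<open>h = v\<close> in \<open>Mv\<close> gives (\<alpha> - 1) v . M v =
    0. For the flow this says that |V| is constant along trajectories.\<close>
  have vMv: "v \<bullet> (M *v v) = 0"
    using Mv[of v] a1 by (simp add: inner_commute)
  have xMx: "x \<bullet> (M *v x) = 0" using Mx xv by simp
  have wMw: "w \<bullet> (M *v w) = 0"
    using trace_frame[of x v M] tr vMv xMx xv by (simp add: w_def)
  have orth: "x \<bullet> w = 0" "v \<bullet> w = 0" "w \<bullet> x = 0" "w \<bullet> v = 0" "v \<bullet> x = 0"
    using xv by (auto simp: w_def dot_cross_self inner_commute)
  have xMw: "x \<bullet> (M *v w) = 0" using xM orth by simp
  have wMx: "w \<bullet> (M *v x) = 0" using Mx orth by simp
  have vMx: "v \<bullet> (M *v x) = - \<alpha> * (v \<bullet> v)" using Mx by simp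
  have xMv: "x \<bullet> (M *v v) = - (v \<bullet> v)" using xM by simp
  have vMw: "v \<bullet> (M *v w) = \<alpha> * (w \<bullet> (M *v v))" using Mv[of w] by (simp add: inner_commute)
  define a b c where "a = (v \<bullet> v) * (n \<bullet> x)" and "b = (x \<bullet> x) * (n \<bullet> v)" and "c = n \<bullet> w"
  have n: "D *\<^sub>R n = a *\<^sub>R x + b *\<^sub>R v + c *\<^sub>R w"
    using frame_expansion[OF xv, of n] by (simp add: D_def a_def b_def c_def w_def)
  have Mn: "D *\<^sub>R (M *v n) = a *\<^sub>R (M *v x) + b *\<^sub>R (M *v v) + c *\<^sub>R (M *v w)"
    by (simp flip: n matrix_vector_mult_scaleR add: matrix_vector_right_distrib[symmetric])
  \<comment> \<open>Only the mixed pairs x, v and v, w survive, and in each of them the two entries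
    of \<open>M\<close> combine to a factor 1 + \<alpha>.\<close>
  have q: "D^2 * (n \<bullet> (M *v n)) = b * (1 + \<alpha>) * (c * (w \<bullet> (M *v v)) - a * (v \<bullet> v))"
  proof -
    have "D^2 * (n \<bullet> (M *v n)) = (D *\<^sub>R n) \<bullet> (D *\<^sub>R (M *v n))"
      by (simp add: power2_eq_square)
    also have "\<dots> = b * (1 + \<alpha>) * (c * (w \<bullet> (M *v v)) - a * (v \<bullet> v))"
      unfolding n Mn inner_add_left inner_add_right inner_scaleR_left inner_scaleR_right
        xMx vMv wMw xMw wMx vMx xMv vMw
      by (simp add: algebra_simps)
    finally show ?thesis .
  qed
  have vn: "D * (v \<bullet> n) = b * (v \<bullet> v)"
    using arg_cong[OF n, of "\<lambda>u. v \<bullet> u"] orth by (simp add: inner_add_right)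
  have mn: "D * ((M *v v) \<bullet> n) = c * (w \<bullet> (M *v v)) - a * (v \<bullet> v)"
    using arg_cong[OF n, of "\<lambda>u. (M *v v) \<bullet> u"] vMv xMv
    by (simp add: inner_add_right inner_commute)
  have "D^2 * ((v \<bullet> v) * (n \<bullet> (M *v n))) = (v \<bullet> v) * (D^2 * (n \<bullet> (M *v n)))"
    by (simp only: mult.left_commute)
  also have "\<dots> = (1 + \<alpha>) * (D * (v \<bullet> n)) * (D * ((M *v v) \<bullet> n))"
    unfolding vn mn q by (simp only: mult_ac)
  also have "\<dots> = D^2 * ((1 + \<alpha>) * (v \<bullet> n) * ((M *v v) \<bullet> n))"
    by (simp add: power2_eq_square)
  finally show ?thesis using D by simp
qed

subsection \<open>Fields with skew derivative\<close>

text \<open>On the segment from y to x the function (x - y) . Y has derivative (x - y) . Y'(x - y) =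
  0, so its values at the two ends agree.\<close>

lemma skew_derivative_imp_orthogonal_increment:
  fixes Y :: "'a::real_inner \<Rightarrow> 'a"
  assumes S: "convex S" and x: "x \<in> S" and y: "y \<in> S"
    and d: "\<And>z. z \<in> S \<Longrightarrow> (Y has_derivative Y' z) (at z)"
    and skew: "\<And>z h. z \<in> S \<Longrightarrow> h \<bullet> Y' z h = 0"
  shows "(Y x - Y y) \<bullet> (x - y) = 0"
proof -
  have seg: "y + t *\<^sub>R (x - y) \<in> S" if "t \<in> {0..1}" for t
    using convexD_alt[OF S y x, of t] that by (simp add: algebra_simps)
  have der: "((\<lambda>t. (x - y) \<bullet> Y (y + t *\<^sub>R (x - y))) has_derivative (\<lambda>_. 0)) (at t within {0..1})"
    if t: "t \<in> {0..1}" for t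
  proof -
    let ?z = "y + t *\<^sub>R (x - y)"
    have "((\<lambda>t. y + t *\<^sub>R (x - y)) has_derivative (\<lambda>s. s *\<^sub>R (x - y))) (at t within {0..1})"
      by (auto intro!: derivative_eq_intros)
    from has_derivative_compose[OF this d[OF seg[OF t]]]
    have "((\<lambda>t. Y (y + t *\<^sub>R (x - y))) has_derivative (\<lambda>s. Y' ?z (s *\<^sub>R (x - y)))) (at t within {0..1})" .
    from has_derivative_inner_right[OF this, of "x - y"]
    show ?thesis
      using skew[OF seg[OF t], of "x - y"] linear_cmul[OF has_derivative_linear[OF d[OF seg[OF t]]]]
      by simp
  qed
  have "\<exists>c. \<forall>t\<in>{0..1::real}. (x - y) \<bullet> Y (y + t *\<^sub>R (x - y)) = c"
    by (rule has_derivative_zero_constant) (use der in auto)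
  then obtain c where c: "\<And>t. t \<in> {0..1::real} \<Longrightarrow> (x - y) \<bullet> Y (y + t *\<^sub>R (x - y)) = c" by blast
  show ?thesis using c[of 0] c[of 1] by (simp add: inner_diff_left inner_diff_right inner_commute)
qed

text \<open>Polarization turns the hypothesis into skewness of the increment \<open>u\<close>, and
  testing a skew map against multiples of the basis vectors shows that it is linear.\<close>

lemma orthogonal_increment_imp_cross:
  fixes Y :: "real^3 \<Rightarrow> real^3"
  assumes r: "r > 0"
    and o: "\<And>x y. x \<in> ball a r \<Longrightarrow> y \<in> ball a r \<Longrightarrow> (Y x - Y y) \<bullet> (x - y) = 0"
  obtains E where "\<And>x. x \<in> ball a r \<Longrightarrow> Y x = Y a + E \<times> (x - a)"
proof -
  define u where "u h = Y (a + h) - Y a" for h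
  have uh: "u h \<bullet> h = 0" if "norm h < r" for h
    using o[of "a + h" a] that r by (simp add: u_def dist_norm)
  have uhk: "u h \<bullet> k = - (u k \<bullet> h)" if "norm h < r" "norm k < r" for h k
    using o[of "a + h" "a + k"] uh[OF that(1)] uh[OF that(2)] that
    by (simp add: u_def dist_norm algebra_simps inner_diff_left inner_diff_right)
  define d where "d = r / 2"
  have d: "d > 0" "d < r" using r by (auto simp: d_def)
  \<comment> \<open>By \<open>uhk\<close>, this is row i of the matrix of \<open>u\<close>; the
    length \<open>d\<close> keeps the test vectors inside the ball.\<close>
  define k where "k i = (- 1 / d) *\<^sub>R u (d *\<^sub>R axis i 1)" for i :: 3
  have uk: "u h $ i = k i \<bullet> h" if "norm h < r" for h i
  proof -
    have "norm (d *\<^sub>R axis i (1::real)) < r" using d by (simp add: norm_axis_1)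
    from uhk[OF that this] have "d * u h $ i = - (u (d *\<^sub>R axis i 1) \<bullet> h)"
      by (simp add: inner_axis)
    then show ?thesis using d by (simp add: k_def field_simps)
  qed
  have skew: "k i $ j = - (k j $ i)" for i j
  proof -
    have n: "norm (d *\<^sub>R axis i (1::real)) < r" for i :: 3 using d by (simp add: norm_axis_1)
    show ?thesis
      using uhk[OF n[of i] n[of j]] d by (simp add: k_def inner_axis field_simps)
  qed
  have diag: "k i $ i = 0" for i using skew[of i i] by simp
  define E where "E = (vector [k 3 $ 2, k 1 $ 3, k 2 $ 1] :: real^3)"
  have "u h = E \<times> h" if "norm h < r" for h
    unfolding vec_eq_iff forall_3
    using skew[of 1 2] skew[of 1 3] skew[of 2 3]
    by (simp add: uk[OF that] E_def cross_components vector_3 inner_vec_def sum_3 diag)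
  from this[of "x - a" for x] have "Y x = Y a + E \<times> (x - a)" if "x \<in> ball a r" for x
    using that by (simp add: u_def dist_norm norm_minus_commute algebra_simps)
  then show thesis using that by blast
qed

text \<open>The set is the image of (plane orthogonal to E without 0) times the line under (w, s) to
  w + s E, and a plane stays connected when a point is removed. Local descriptions of the flow are
  continued along this set.\<close>

lemma connected_complement_line:
  fixes E :: "real^3"
  assumes "E \<noteq> 0"
  shows "connected {X. E \<times> X \<noteq> 0}"
proof -
  let ?P = "{w. E \<bullet> w = 0}"
  have "\<not> collinear ?P"
    using assms by (simp add: collinear_aff_dim aff_dim_hyperplane)
  then have c: "connected (?P - {0})"
    by (intro connected_convex_diff_countable convex_hyperplane) auto
  define g where "g q = fst q + snd q *\<^sub>R E" for q :: "(real^3) \<times> real"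
  have "continuous_on (Sigma (?P - {0}) (\<lambda>_. UNIV)) g" unfolding g_def by (intro continuous_intros)
  then have "connected (g ` (Sigma (?P - {0}) (\<lambda>_. UNIV)))"
    by (intro connected_continuous_image connected_Times c connected_UNIV)
  moreover have "g ` (Sigma (?P - {0}) (\<lambda>_. UNIV)) = {X. E \<times> X \<noteq> 0}"
  proof (intro set_eqI iffI)
    fix X assume "X \<in> g ` (Sigma (?P - {0}) (\<lambda>_. UNIV))"
    then obtain w s where "E \<bullet> w = 0" "w \<noteq> 0" "X = w + s *\<^sub>R E"
      unfolding g_def by fastforce
    then show "X \<in> {X. E \<times> X \<noteq> 0}"
      using norm_and_cross_eq_0[of E w] assms by (auto simp: cross_add_right cross_mult_right)
  next
    fix X assume X: "X \<in> {X. E \<times> X \<noteq> 0}"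
    define s where "s = (E \<bullet> X) / (E \<bullet> E)"
    have "X = g (X - s *\<^sub>R E, s)" by (simp add: g_def)
    moreover have "E \<bullet> (X - s *\<^sub>R E) = 0" using assms by (simp add: s_def inner_diff_right)
    moreover have "X - s *\<^sub>R E \<noteq> 0" using X by (auto simp: cross_mult_right)
    ultimately show "X \<in> g ` (Sigma (?P - {0}) (\<lambda>_. UNIV))" by blast
  qed
  ultimately show ?thesis by simp
qed

subsection \<open>Homogeneous tangential flows\<close>

text \<open>Homogeneity is a scaling law, ready to be differentiated in \<open>s\<close> at
  \<open>s = 1\<close>; \<open>tangent\<close> encodes f = 0.\<close>

locale homogeneous_tangential_flow =
  fixes \<alpha> :: real and V :: "real^3 \<Rightarrow> real^3" and P :: "real^3 \<Rightarrow> real"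
  assumes V_scale: "X \<noteq> 0 \<Longrightarrow> s > 0 \<Longrightarrow> V (s *\<^sub>R X) = s powr (- \<alpha>) *\<^sub>R V X"
    and P_scale: "X \<noteq> 0 \<Longrightarrow> s > 0 \<Longrightarrow> P (s *\<^sub>R X) = s powr (- (2 * \<alpha>)) * P X"
    and tangent: "X \<noteq> 0 \<Longrightarrow> X \<bullet> V X = 0"
    and euler: "stationary_euler_on (UNIV - {0}) V P"
begin

section \<open>First-order identities for \<open>V\<close> and \<open>P\<close>\<close>

abbreviation "DV X \<equiv> jacobian V (at X)"

lemma V_deriv: "X \<noteq> 0 \<Longrightarrow> (V has_derivative (\<lambda>h. DV X *v h)) (at X)"
  using euler unfolding stationary_euler_on_def jacobian_works by blast

lemma V_cont: "X \<noteq> 0 \<Longrightarrow> isCont V X"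
  using V_deriv has_derivative_continuous by blast

lemma DV_trace: "X \<noteq> 0 \<Longrightarrow> trace (DV X) = 0"
  using euler unfolding stationary_euler_on_def by blast

lemma powr_scale_deriv: "((\<lambda>s::real. s powr b) has_derivative (\<lambda>h. h * b)) (at 1)"
  by (auto intro!: derivative_eq_intros)

text \<open>Euler's identity for homogeneous maps: the derivative along the ray through X is
  computed once by the chain rule and once from the scaling law.\<close>

lemma DV_radial:
  assumes X: "X \<noteq> 0"
  shows "DV X *v X = (- \<alpha>) *\<^sub>R V X"
proof -
  have "((\<lambda>s::real. s *\<^sub>R X) has_derivative (\<lambda>h. h *\<^sub>R X)) (at 1)"
    by (auto intro!: derivative_eq_intros)
  moreover have "(V has_derivative (\<lambda>h. DV X *v h)) (at (1 *\<^sub>R X))" using V_deriv[OF X] by simp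
  ultimately have 1: "((\<lambda>s::real. V (s *\<^sub>R X)) has_derivative (\<lambda>h. DV X *v (h *\<^sub>R X))) (at 1)"
    by (rule has_derivative_compose)
  have "((\<lambda>s::real. s powr (- \<alpha>) *\<^sub>R V X) has_derivative (\<lambda>h. (h * (- \<alpha>)) *\<^sub>R V X)) (at 1)"
    by (rule has_derivative_scaleR_left[OF powr_scale_deriv])
  then have 2: "((\<lambda>s::real. V (s *\<^sub>R X)) has_derivative (\<lambda>h. (h * (- \<alpha>)) *\<^sub>R V X)) (at 1)"
    by (rule has_derivative_transform_within_open[of _ _ _ _ "{0<..}"]) (auto simp: V_scale[OF X])
  show ?thesis using fun_cong[OF has_derivative_unique[OF 1 2], of 1] by simp
qed

lemma DV_tangent:
  assumes X: "X \<noteq> 0"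
  shows "X \<bullet> (DV X *v h) = - (V X \<bullet> h)"
proof -
  have 1: "((\<lambda>X. X \<bullet> V X) has_derivative (\<lambda>h. X \<bullet> (DV X *v h) + h \<bullet> V X)) (at X)"
    by (rule has_derivative_inner[OF has_derivative_ident V_deriv[OF X]])
  have "((\<lambda>X::real^3. 0::real) has_derivative (\<lambda>h. 0)) (at X)" by simp
  then have 2: "((\<lambda>X. X \<bullet> V X) has_derivative (\<lambda>h. 0)) (at X)"
    by (rule has_derivative_transform_within_open[of _ _ _ _ "- {0}"]) (auto simp: X tangent)
  show ?thesis
    using fun_cong[OF has_derivative_unique[OF 1 2], of h] by (simp add: inner_commute)
qed

lemma P_deriv: "X \<noteq> 0 \<Longrightarrow> (P has_derivative (\<lambda>h. - ((DV X *v V X) \<bullet> h))) (at X)"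
proof -
  assume "X \<noteq> 0"
  then obtain g where g: "GDERIV P X :> g" "DV X *v V X + g = 0"
    using euler unfolding stationary_euler_on_def by blast
  then have "g = - (DV X *v V X)" by (simp add: eq_neg_iff_add_eq_0 add.commute)
  then show ?thesis using g(1) by (simp add: gderiv_def inner_commute)
qed

text \<open>Radial component of the momentum equation: X . (DV V) = -|V|^2 by
  \<open>DV_tangent\<close>, and X . grad P = -2 \<alpha> P by Euler's identity.\<close>

lemma P_eq:
  assumes X: "X \<noteq> 0"
  shows "V X \<bullet> V X = - 2 * \<alpha> * P X"
proof -
  have "((\<lambda>s::real. s *\<^sub>R X) has_derivative (\<lambda>h. h *\<^sub>R X)) (at 1)"
    by (auto intro!: derivative_eq_intros)
  moreover have "(P has_derivative (\<lambda>h. - ((DV X *v V X) \<bullet> h))) (at (1 *\<^sub>R X))"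
    using P_deriv[OF X] by simp
  ultimately have 1: "((\<lambda>s::real. P (s *\<^sub>R X)) has_derivative (\<lambda>h. - ((DV X *v V X) \<bullet> (h *\<^sub>R X)))) (at 1)"
    by (rule has_derivative_compose)
  have "((\<lambda>s::real. s powr (- (2 * \<alpha>)) * P X) has_derivative (\<lambda>h. (h * (- (2 * \<alpha>))) * P X)) (at 1)"
    by (rule has_derivative_mult_left[OF powr_scale_deriv])
  then have 2: "((\<lambda>s::real. P (s *\<^sub>R X)) has_derivative (\<lambda>h. (h * (- (2 * \<alpha>))) * P X)) (at 1)"
    by (rule has_derivative_transform_within_open[of _ _ _ _ "{0<..}"]) (auto simp: P_scale[OF X])
  show ?thesis
    using fun_cong[OF has_derivative_unique[OF 1 2], of 1] DV_tangent[OF X, of "V X"]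
    by (simp add: inner_commute)
qed

text \<open>\<open>V \<cdot> \<nabla>V = \<nabla>|V|\<^sup>2 / (2 \<alpha>)\<close>, because \<open>P = - |V|\<^sup>2 / (2 \<alpha>)\<close>.\<close>

lemma DV_gradient:
  assumes X: "X \<noteq> 0"
  shows "\<alpha> * ((DV X *v V X) \<bullet> h) = V X \<bullet> (DV X *v h)"
proof -
  have 1: "((\<lambda>X. V X \<bullet> V X) has_derivative (\<lambda>h. V X \<bullet> (DV X *v h) + (DV X *v h) \<bullet> V X)) (at X)"
    by (rule has_derivative_inner[OF V_deriv[OF X] V_deriv[OF X]])
  have "((\<lambda>X. - 2 * \<alpha> * P X) has_derivative (\<lambda>h. - 2 * \<alpha> * (- ((DV X *v V X) \<bullet> h)))) (at X)"
    by (rule has_derivative_mult_right[OF P_deriv[OF X]])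
  then have 2: "((\<lambda>X. V X \<bullet> V X) has_derivative (\<lambda>h. - 2 * \<alpha> * (- ((DV X *v V X) \<bullet> h)))) (at X)"
    by (rule has_derivative_transform_within_open[of _ _ _ _ "- {0}"]) (auto simp: X P_eq)
  show ?thesis
    using fun_cong[OF has_derivative_unique[OF 1 2], of h] by (simp add: inner_commute)
qed

lemma V_eq_0_if_alpha_0: "\<alpha> = 0 \<Longrightarrow> X \<noteq> 0 \<Longrightarrow> V X = 0"
  using P_eq[of X] by simp

text \<open>The exponent makes |Y| = |V| powr (-1/\<alpha>), homogeneous of degree 1. If V is |E
  \<times> X| powr (-\<alpha> - 1) times E \<times> X, then Y is the rigid rotation E \<times> X
  itself.\<close>

definition Y :: "real^3 \<Rightarrow> real^3"
  where "Y X = norm (V X) powr (- 1 / \<alpha> - 1) *\<^sub>R V X"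

text \<open>Up to the factor |V| powr b, the product rule adds b (V . DV h)(V . h) / |V|^2 to h . DV
  h. By \<open>DV_gradient\<close> and \<open>quadratic_form_of_gradient\<close> the sum cancels
  because b \<alpha> = -(1 + \<alpha>).\<close>

lemma skew_derivative_Y:
  assumes X: "X \<noteq> 0" and VX: "V X \<noteq> 0" and a: "\<alpha> \<noteq> 0" "\<alpha> \<noteq> 1"
  obtains Y' where "(Y has_derivative Y') (at X)" "\<And>h. h \<bullet> Y' h = 0"
proof -
  define b where "b = - 1 / \<alpha> - 1"
  have n: "((\<lambda>X. norm (V X)) has_derivative (\<lambda>h. sgn (V X) \<bullet> (DV X *v h))) (at X)"
    using has_derivative_compose[OF V_deriv[OF X] has_derivative_norm[OF VX]]
    by (simp add: inner_commute)
  have "((\<lambda>X. norm (V X) powr b) has_derivative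
      (\<lambda>h. norm (V X) powr b * (b * ((V X \<bullet> (DV X *v h)) / (V X \<bullet> V X))))) (at X)"
    using VX by (auto intro!: derivative_eq_intros n
        simp: sgn_div_norm field_simps power2_norm_eq_inner[symmetric] power2_eq_square)
  from has_derivative_scaleR[OF this V_deriv[OF X]]
  have 1: "(Y has_derivative (\<lambda>h. norm (V X) powr b *\<^sub>R (DV X *v h) +
      (norm (V X) powr b * (b * ((V X \<bullet> (DV X *v h)) / (V X \<bullet> V X)))) *\<^sub>R V X)) (at X)"
    by (simp add: Y_def[abs_def] b_def)
  show thesis
  proof (rule that[OF 1])
    fix h
    have q: "(V X \<bullet> V X) * (h \<bullet> (DV X *v h)) = (1 + \<alpha>) * (V X \<bullet> h) * ((DV X *v V X) \<bullet> h)"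
      by (rule quadratic_form_of_gradient[OF tangent[OF X] X VX DV_radial[OF X] DV_tangent[OF X]
            DV_trace[OF X] DV_gradient[OF X] a(2)])
    have "h \<bullet> (DV X *v h) + b * ((V X \<bullet> (DV X *v h)) / (V X \<bullet> V X)) * (h \<bullet> V X) = 0"
      using q VX a unfolding DV_gradient[OF X, of h, symmetric] b_def
      by (simp add: field_simps inner_commute)
    then have "norm (V X) powr b * (h \<bullet> (DV X *v h) + b * ((V X \<bullet> (DV X *v h)) / (V X \<bullet> V X)) * (h \<bullet> V X)) = 0"
      by simp
    then show "h \<bullet> (norm (V X) powr b *\<^sub>R (DV X *v h) +
      (norm (V X) powr b * (b * ((V X \<bullet> (DV X *v h)) / (V X \<bullet> V X)))) *\<^sub>R V X) = 0"
      by (simp add: inner_add_right algebra_simps)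
  qed
qed

end

subsection \<open>Axisymmetric swirls\<close>

text \<open>The coordinate-free form of the axial flow: the direction of \<open>E\<close> is the
  axis, its length encodes the amplitude. On the axis the value is 0.\<close>

definition swirl :: "real \<Rightarrow> real^3 \<Rightarrow> real^3 \<Rightarrow> real^3"
  where "swirl \<alpha> E X = norm (E \<times> X) powr (- \<alpha> - 1) *\<^sub>R (E \<times> X)"

lemma norm_swirl: "norm (swirl \<alpha> E X) = norm (E \<times> X) powr (- \<alpha>)"
proof (cases "E \<times> X = 0")
  case False
  then have "norm (swirl \<alpha> E X) = norm (E \<times> X) powr (- \<alpha> - 1) * norm (E \<times> X) powr 1"
    by (simp add: swirl_def)
  also have "\<dots> = norm (E \<times> X) powr (- \<alpha>)" unfolding powr_add[symmetric] by simp
  finally show ?thesis .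
qed (simp add: swirl_def)

lemma isCont_swirl: "E \<times> X \<noteq> 0 \<Longrightarrow> isCont (swirl \<alpha> E) X"
  unfolding swirl_def[abs_def] by (intro continuous_intros continuous_cross) auto

text \<open>Equal lengths force |E \<times> X| = |F \<times> X|, since a power with nonzero exponent
  is injective; then the common scalar factor cancels.\<close>

lemma swirl_eqD:
  assumes "swirl \<alpha> E X = swirl \<alpha> F X" "E \<times> X \<noteq> 0" "F \<times> X \<noteq> 0" "\<alpha> \<noteq> 0"
  shows "E \<times> X = F \<times> X"
proof -
  have "norm (E \<times> X) powr (- \<alpha>) = norm (F \<times> X) powr (- \<alpha>)"
    using assms(1) norm_swirl by metis
  then have "(norm (E \<times> X) powr (- \<alpha>)) powr (- 1 / \<alpha>) = (norm (F \<times> X) powr (- \<alpha>)) powr (- 1 / \<alpha>)"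
    by simp
  then have "norm (E \<times> X) = norm (F \<times> X)"
    using assms(4) by (simp add: powr_powr)
  then show ?thesis using assms by (simp add: swirl_def)
qed

lemma cross_eq_on_ball_imp_eq:
  fixes E F a :: "real^3"
  assumes r: "r > 0" and eq: "\<And>X. X \<in> ball a r \<Longrightarrow> E \<times> X = F \<times> X"
  shows "E = F"
proof (rule ccontr)
  assume "E \<noteq> F"
  then have "E - F \<noteq> 0" by simp
  then obtain i where i: "(E - F) \<times> axis i 1 \<noteq> 0" using cross_basis_nonzero by blast
  have "a + (r / 2) *\<^sub>R axis i 1 \<in> ball a r" "a \<in> ball a r"
    using r by (auto simp: dist_norm norm_axis_1)
  then have "E \<times> (a + (r / 2) *\<^sub>R axis i 1) = F \<times> (a + (r / 2) *\<^sub>R axis i 1)" "E \<times> a = F \<times> a"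
    using eq by blast+
  then have "(E - F) \<times> axis i 1 = 0"
    using r by (simp add: cross_add_right cross_mult_right Cross3.left_diff_distrib)
  then show False using i by simp
qed

section \<open>Local form of the flow, its continuation, and its behaviour at the axis\<close>

context homogeneous_tangential_flow
begin

lemma Y_scale:
  assumes "X \<noteq> 0" "V X \<noteq> 0" "s > 0" "\<alpha> \<noteq> 0"
  shows "Y (s *\<^sub>R X) = s *\<^sub>R Y X"
proof -
  have "norm (V (s *\<^sub>R X)) = s powr (- \<alpha>) * norm (V X)" using assms by (simp add: V_scale)
  then have "Y (s *\<^sub>R X) = (s powr (- \<alpha> * (- 1 / \<alpha> - 1)) * s powr (- \<alpha>)) *\<^sub>R Y X"
    using assms by (simp add: Y_def V_scale powr_mult powr_powr)
  also have "s powr (- \<alpha> * (- 1 / \<alpha> - 1)) * s powr (- \<alpha>) = s"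
    unfolding powr_add[symmetric] using assms by (simp add: algebra_simps)
  finally show ?thesis .
qed

lemma locally_swirl:
  assumes X: "X \<noteq> 0" and VX: "V X \<noteq> 0" and a: "\<alpha> \<noteq> 0" "\<alpha> \<noteq> 1"
  obtains E r where "r > 0"
    "\<And>Z. Z \<in> ball X r \<Longrightarrow> Z \<noteq> 0 \<and> E \<times> Z \<noteq> 0 \<and> V Z = swirl \<alpha> E Z"
proof -
  obtain r1 where r1: "r1 > 0" "\<And>Z. dist X Z < r1 \<Longrightarrow> V Z \<noteq> 0"
    using continuous_at_avoid[OF V_cont[OF X] VX] by blast
  \<comment> \<open>The bound by \<open>norm X\<close> keeps the origin out of the ball.\<close>
  define r where "r = min r1 (norm X)"
  have r: "r > 0" using r1 X by (simp add: r_def)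
  have ne: "Z \<noteq> 0" "V Z \<noteq> 0" if "Z \<in> ball X r" for Z
    using that r1 by (auto simp: r_def)
  have "\<exists>D. (Y has_derivative D) (at Z) \<and> (\<forall>h. h \<bullet> D h = 0)" if "Z \<in> ball X r" for Z
    using skew_derivative_Y[OF ne[OF that] a] by blast
  then obtain Y' where Y': "\<And>Z. Z \<in> ball X r \<Longrightarrow> (Y has_derivative Y' Z) (at Z)"
      "\<And>Z h. Z \<in> ball X r \<Longrightarrow> h \<bullet> Y' Z h = 0" by metis
  have "(Y x - Y y) \<bullet> (x - y) = 0" if "x \<in> ball X r" "y \<in> ball X r" for x y
    using skew_derivative_imp_orthogonal_increment[OF convex_ball that Y'] by blast
  then obtain E where E: "\<And>Z. Z \<in> ball X r \<Longrightarrow> Y Z = Y X + E \<times> (Z - X)"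
    using orthogonal_increment_imp_cross[OF r] by blast
  \<comment> \<open>A multiple of X at distance r / 2 from X. Comparing the affine formula there
    with homogeneity of degree 1 removes the translation part: Y X = E \<times> X.\<close>
  define s where "s = 1 + r / (2 * norm X)"
  have s: "s > 1" using r X by (simp add: s_def)
  have "dist X (s *\<^sub>R X) = norm ((s - 1) *\<^sub>R X)"
    by (simp add: dist_norm algebra_simps norm_minus_commute)
  also have "\<dots> = r / 2" using r X by (simp add: s_def)
  finally have "Y (s *\<^sub>R X) = Y X + E \<times> (s *\<^sub>R X - X)" using r by (intro E) simp
  moreover have "Y (s *\<^sub>R X) = s *\<^sub>R Y X" using Y_scale X VX s a by simp
  ultimately have "(s - 1) *\<^sub>R Y X = (s - 1) *\<^sub>R (E \<times> X)"
    by (simp add: algebra_simps cross_mult_right Cross3.right_diff_distrib)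
  then have YX: "Y X = E \<times> X" using s by simp
  show thesis
  proof (rule that[OF r])
    fix Z assume Z: "Z \<in> ball X r"
    have YZ: "Y Z = E \<times> Z" using E[OF Z] YX by (simp add: Cross3.right_diff_distrib)
    define m where "m = norm (V Z)"
    have m: "m > 0" using ne[OF Z] by (simp add: m_def)
    have "norm (E \<times> Z) = m powr (- 1 / \<alpha> - 1) * m powr 1"
      using m by (simp flip: YZ add: Y_def m_def)
    also have "\<dots> = m powr (- 1 / \<alpha>)" unfolding powr_add[symmetric] by simp
    finally have nE: "norm (E \<times> Z) = m powr (- 1 / \<alpha>)" .
    \<comment> \<open>The passage from V to Y is inverted: |E \<times> Z| = |V Z| powr (-1/\<alpha>)
      determines the factor between Y Z and V Z.\<close>
    have "swirl \<alpha> E Z = (m powr ((- 1 / \<alpha>) * (- \<alpha> - 1)) * m powr (- 1 / \<alpha> - 1)) *\<^sub>R V Z"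
      unfolding swirl_def nE powr_powr by (simp flip: YZ add: Y_def m_def)
    also have "m powr ((- 1 / \<alpha>) * (- \<alpha> - 1)) * m powr (- 1 / \<alpha> - 1) = 1"
      unfolding powr_add[symmetric] using m a by (simp add: field_simps)
    finally have "V Z = swirl \<alpha> E Z" by simp
    moreover have "E \<times> Z \<noteq> 0"
      using nE m by (metis norm_eq_zero powr_eq_0_iff less_irrefl)
    ultimately show "Z \<noteq> 0 \<and> E \<times> Z \<noteq> 0 \<and> V Z = swirl \<alpha> E Z" using ne[OF Z] by blast
  qed
qed

text \<open>Continuation along the connected complement of the axis: agreement with one fixed swirl
  near a point is a locally constant property.\<close>

lemma globally_swirl:
  assumes X: "X \<noteq> 0" and VX: "V X \<noteq> 0" and a: "\<alpha> \<noteq> 0" "\<alpha> \<noteq> 1"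
  obtains E where "E \<noteq> 0" "\<And>Z. E \<times> Z \<noteq> 0 \<Longrightarrow> V Z = swirl \<alpha> E Z"
proof -
  obtain E r where r: "r > 0"
    and E: "\<And>Z. Z \<in> ball X r \<Longrightarrow> Z \<noteq> 0 \<and> E \<times> Z \<noteq> 0 \<and> V Z = swirl \<alpha> E Z"
    by (rule locally_swirl[OF assms]) blast
  have EX: "E \<times> X \<noteq> 0" using E r by simp
  then have E0: "E \<noteq> 0" by auto
  let ?D = "{Z. E \<times> Z \<noteq> 0}"
  have oD: "open ?D"
    by (intro open_Collect_neq continuous_intros continuous_on_cross)
  \<comment> \<open>Agreement is required on a whole neighbourhood, because \<open>E\<close> can be
    recovered from an open set but not from a single point.\<close>
  let ?Q = "\<lambda>Z. \<forall>\<^sub>F W in nhds Z. V W = swirl \<alpha> E W"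
  have "?Q Z" if Z: "Z \<in> ?D" for Z
  proof (rule connected_induction_simple[OF connected_complement_line[OF E0], of X Z ?Q])
    show "X \<in> ?D" "Z \<in> ?D" using EX Z by auto
    show "?Q X"
      unfolding eventually_nhds using E r by (intro exI[of _ "ball X r"]) auto
    fix W assume W: "W \<in> ?D"
    then have W0: "W \<noteq> 0" by auto
    have "\<exists>d>0. ball W d \<subseteq> ?D \<and> (\<forall>x\<in>ball W d. \<forall>y\<in>ball W d. ?Q x \<longrightarrow> ?Q y)"
    proof (cases "V W = swirl \<alpha> E W")
      \<comment> \<open>By continuity the two fields then differ throughout a ball, so
        \<open>?Q\<close> fails at each of its points.\<close>
      case False
      have "isCont (\<lambda>Z. V Z - swirl \<alpha> E Z) W"
        using V_cont[OF W0] isCont_swirl W by (intro continuous_intros) auto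
      then obtain d1 where d1: "d1 > 0" "\<And>Z. dist W Z < d1 \<Longrightarrow> V Z - swirl \<alpha> E Z \<noteq> 0"
        using continuous_at_avoid[of W "\<lambda>Z. V Z - swirl \<alpha> E Z" 0] False by auto
      obtain d2 where d2: "d2 > 0" "ball W d2 \<subseteq> ?D" using oD W open_contains_ball by blast
      have "\<not> ?Q x" if "x \<in> ball W d1" for x
        using d1(2)[of x] that eventually_nhds_x_imp_x by fastforce
      then show ?thesis using d1 d2 by (intro exI[of _ "min d1 d2"]) auto
    next
      case True
      then have VW: "V W \<noteq> 0" using W by (auto simp: swirl_def)
      obtain F d1 where d1: "d1 > 0"
        and F: "\<And>Z. Z \<in> ball W d1 \<Longrightarrow> Z \<noteq> 0 \<and> F \<times> Z \<noteq> 0 \<and> V Z = swirl \<alpha> F Z"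
        by (rule locally_swirl[OF W0 VW a]) blast
      obtain d2 where d2: "d2 > 0" "ball W d2 \<subseteq> ?D" using oD W open_contains_ball by blast
      define d where "d = min d1 d2"
      have "?Q y" if x: "x \<in> ball W d" and Q: "?Q x" and y: "y \<in> ball W d" for x y
      proof -
        \<comment> \<open>Where the local swirl around \<open>W\<close> and the given one overlap in
          a small ball, their vectors \<open>F\<close> and \<open>E\<close> must coincide.\<close>
        obtain T where T: "open T" "x \<in> T" "\<And>Z. Z \<in> T \<Longrightarrow> V Z = swirl \<alpha> E Z"
          using Q unfolding eventually_nhds by blast
        have "open (T \<inter> ball W d)" "x \<in> T \<inter> ball W d" using T x by auto
        then obtain e where e: "e > 0" "ball x e \<subseteq> T \<inter> ball W d"
          using open_contains_ball by metis
        have "E \<times> Z = F \<times> Z" if "Z \<in> ball x e" for Z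
        proof (rule swirl_eqD[OF _ _ _ a(1)])
          have "Z \<in> T" "Z \<in> ball W d" using that e by auto
          then have Z: "Z \<in> T" "Z \<in> ball W d1" "Z \<in> ?D" using d2 by (auto simp: d_def)
          show "swirl \<alpha> E Z = swirl \<alpha> F Z" "E \<times> Z \<noteq> 0" "F \<times> Z \<noteq> 0"
            using T(3)[OF Z(1)] F[OF Z(2)] Z(3) by auto
        qed
        then have "E = F" using cross_eq_on_ball_imp_eq e(1) by blast
        then show ?thesis
          unfolding eventually_nhds using F y by (intro exI[of _ "ball W d1"]) (auto simp: d_def)
      qed
      then have "\<forall>x\<in>ball W d. \<forall>y\<in>ball W d. ?Q x \<longrightarrow> ?Q y" by blast
      moreover have "d > 0" "ball W d \<subseteq> ?D" using d1 d2 by (auto simp: d_def)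
      ultimately show ?thesis by blast
    qed
    then obtain d where d: "d > 0" "ball W d \<subseteq> ?D"
        "\<forall>x\<in>ball W d. \<forall>y\<in>ball W d. ?Q x \<longrightarrow> ?Q y" by blast
    show "\<exists>T. openin (top_of_set ?D) T \<and> W \<in> T \<and> (\<forall>x\<in>T. \<forall>y\<in>T. ?Q x \<longrightarrow> ?Q y)"
      using open_subset[OF d(2) open_ball] d(1,3) centre_in_ball by blast
  qed
  then have "V Z = swirl \<alpha> E Z" if "E \<times> Z \<noteq> 0" for Z
    using that eventually_nhds_x_imp_x by fastforce
  then show thesis using that E0 by blast
qed

text \<open>Near the axis, \<open>|V|\<close> behaves like the power \<open>-\<alpha>\<close> of the distance, whereas a differentiable field
  changes at most linearly.\<close>

lemma swirl_imp_alpha_le: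
  assumes E: "E \<noteq> 0" and sw: "\<And>Z. E \<times> Z \<noteq> 0 \<Longrightarrow> V Z = swirl \<alpha> E Z"
  shows "\<alpha> \<le> -1"
proof (rule ccontr)
  assume "\<not> \<alpha> \<le> -1"
  then have a: "\<alpha> + 1 > 0" by simp
  obtain i where i: "E \<times> axis i 1 \<noteq> 0" using cross_basis_nonzero[OF E] by blast
  define n :: "real^3" where "n = axis i 1"
  define c where "c = norm (E \<times> n)"
  have c: "c > 0" using i by (simp add: c_def n_def)
  have cr: "E \<times> (E + t *\<^sub>R n) = t *\<^sub>R (E \<times> n)" for t by (simp add: cross_add_right cross_mult_right)
  \<comment> \<open>The difference is taken across the axis at the axis point E. The swirl is odd in
    \<open>t\<close>, so the two values add up to length 2 (t c) powr (-\<alpha>).\<close>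
  let ?g = "\<lambda>t::real. V (E + t *\<^sub>R n) - V (E + (- t) *\<^sub>R n)"
  have ng: "norm (?g t) = 2 * (t * c) powr (- \<alpha>)" if t: "t > 0" for t
  proof -
    have "E \<times> n \<noteq> 0" using i by (simp add: n_def)
    then have "?g t = swirl \<alpha> E (E + t *\<^sub>R n) - swirl \<alpha> E (E + (- t) *\<^sub>R n)"
      using t sw[of "E + t *\<^sub>R n"] sw[of "E + (- t) *\<^sub>R n"] cr[of t] cr[of "- t"] by simp
    also have "\<dots> = 2 *\<^sub>R swirl \<alpha> E (E + t *\<^sub>R n)"
    proof -
      have "swirl \<alpha> E (E + (- t) *\<^sub>R n) = - swirl \<alpha> E (E + t *\<^sub>R n)"
        unfolding swirl_def cr by simp
      then show ?thesis by (simp only: diff_minus_eq_add scaleR_2)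
    qed
    finally show ?thesis using t by (simp add: norm_swirl cr c_def)
  qed
  have vd: "((\<lambda>t. V (E + (k * t) *\<^sub>R n)) has_derivative (\<lambda>s. DV E *v ((k * s) *\<^sub>R n))) (at 0)" for k :: real
  proof -
    have "((\<lambda>t. E + (k * t) *\<^sub>R n) has_derivative (\<lambda>s. (k * s) *\<^sub>R n)) (at 0)"
      by (auto intro!: derivative_eq_intros)
    moreover have "(V has_derivative (\<lambda>h. DV E *v h)) (at (E + (k * 0) *\<^sub>R n))"
      using V_deriv[OF E] by simp
    ultimately show ?thesis by (rule has_derivative_compose)
  qed
  define D where "D = 2 *\<^sub>R (DV E *v n)"
  have "(?g has_derivative (\<lambda>s. s *\<^sub>R D)) (at 0)"
    using has_derivative_diff[OF vd[of 1] vd[of "-1"]]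
    unfolding matrix_vector_mult_scaleR D_def scaleR_2 by (simp add: scaleR_add_right)
  then have lim: "((\<lambda>t. norm (?g t - t *\<^sub>R D) / norm t) \<longlongrightarrow> 0) (at 0)"
    by (simp add: has_derivative_iff_norm)
  have eq: "\<forall>t. t \<noteq> 0 \<longrightarrow> norm (?g t - t *\<^sub>R D) / norm t = norm (?g t /\<^sub>R t - D)"
  proof (intro allI impI)
    fix t :: real assume that: "t \<noteq> 0"
    have "?g t - t *\<^sub>R D = t *\<^sub>R (?g t /\<^sub>R t - D)" using that by (simp add: scaleR_right_diff_distrib)
    then show "norm (?g t - t *\<^sub>R D) / norm t = norm (?g t /\<^sub>R t - D)"
      using that by (simp only: norm_scaleR) simp
  qed
  have "((\<lambda>t. norm (?g t /\<^sub>R t - D)) \<longlongrightarrow> 0) (at 0)"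
    by (rule iffD1[OF LIM_equal[OF eq] lim])
  then have "((\<lambda>t. ?g t /\<^sub>R t) \<longlongrightarrow> D) (at 0)"
    by (rule LIM_zero_cancel[OF tendsto_norm_zero_cancel])
  then have "((\<lambda>t. norm (?g t /\<^sub>R t)) \<longlongrightarrow> norm D) (at_right 0)"
    by (intro tendsto_norm) (rule filterlim_mono[OF _ order_refl at_le], auto)
  moreover have "((\<lambda>t. t powr (\<alpha> + 1)) \<longlongrightarrow> 0 powr (\<alpha> + 1)) (at_right (0::real))"
    by (rule tendsto_powr') (use a in \<open>auto intro!: tendsto_eq_intros eventually_at_rightI[of 0 1]\<close>)
  \<comment> \<open>Differentiability forces this product to tend to 0, whereas it equals the
    positive constant 2 c powr (-\<alpha>).\<close>
  ultimately have "((\<lambda>t. norm (?g t /\<^sub>R t) * t powr (\<alpha> + 1)) \<longlongrightarrow> norm D * 0 powr (\<alpha> + 1)) (at_right 0)"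
    by (rule tendsto_mult)
  moreover have "\<forall>\<^sub>F t in at_right 0. norm (?g t /\<^sub>R t) * t powr (\<alpha> + 1) = 2 * c powr (- \<alpha>)"
  proof (rule eventually_at_rightI[of 0 1])
    fix t :: real assume "t \<in> {0<..<1}"
    then have t: "t > 0" by simp
    have "norm (?g t /\<^sub>R t) * t powr (\<alpha> + 1) = 2 * c powr (- \<alpha>) * (t powr (- \<alpha>) * t powr (\<alpha> + 1) * t powr (-1))"
    proof -
      have "norm (?g t /\<^sub>R t) = norm (?g t) / t"
        unfolding norm_scaleR using t by (simp add: divide_inverse)
      then show ?thesis
        unfolding ng[OF t] using t c by (simp add: powr_mult powr_minus field_simps)
    qed
    also have "t powr (- \<alpha>) * t powr (\<alpha> + 1) * t powr (-1) = 1"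
      unfolding powr_add[symmetric] using t by simp
    finally show "norm (?g t /\<^sub>R t) * t powr (\<alpha> + 1) = 2 * c powr (- \<alpha>)" by simp
  qed simp
  ultimately have "((\<lambda>t. 2 * c powr (- \<alpha>)) \<longlongrightarrow> norm D * 0 powr (\<alpha> + 1)) (at_right (0::real))"
    using tendsto_cong by fast
  then have "2 * c powr (- \<alpha>) = norm D * 0 powr (\<alpha> + 1)"
    using tendsto_const tendsto_unique trivial_limit_at_right_real by blast
  then show False using c by simp
qed

text \<open>Since \<alpha> \<le> -1, |V| is a positive power of the distance when the axis is
  approached transversally; by continuity V vanishes on the axis, as the swirl does.\<close>

lemma swirl_on_axis:
  assumes E: "E \<noteq> 0" and sw: "\<And>Z. E \<times> Z \<noteq> 0 \<Longrightarrow> V Z = swirl \<alpha> E Z" and X: "X \<noteq> 0"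
  shows "V X = swirl \<alpha> E X"
proof (cases "E \<times> X = 0")
  case EX: True
  have a: "\<alpha> \<le> -1" by (rule swirl_imp_alpha_le[OF E sw])
  obtain i where i: "E \<times> axis i 1 \<noteq> 0" using cross_basis_nonzero[OF E] by blast
  define n :: "real^3" where "n = axis i 1"
  have n: "E \<times> n \<noteq> 0" using i by (simp add: n_def)
  have cr: "E \<times> (X + t *\<^sub>R n) = t *\<^sub>R (E \<times> n)" for t
    using EX by (simp add: cross_add_right cross_mult_right)
  have "((\<lambda>t::real. X + t *\<^sub>R n) \<longlongrightarrow> X + 0 *\<^sub>R n) (at_right 0)" by (intro tendsto_intros)
  then have 1: "((\<lambda>t. norm (V (X + t *\<^sub>R n))) \<longlongrightarrow> norm (V X)) (at_right 0)"
    by (intro tendsto_norm isCont_tendsto_compose[OF V_cont[OF X]]) simp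
  have "((\<lambda>t. (t * norm (E \<times> n)) powr (- \<alpha>)) \<longlongrightarrow> (0 * norm (E \<times> n)) powr (- \<alpha>)) (at_right (0::real))"
    by (rule tendsto_powr') (use a in \<open>auto intro!: tendsto_eq_intros eventually_at_rightI[of 0 1]\<close>)
  moreover have "\<forall>\<^sub>F t in at_right (0::real). (t * norm (E \<times> n)) powr (- \<alpha>) = norm (V (X + t *\<^sub>R n))"
    using n by (intro eventually_at_rightI[of 0 1]) (simp_all add: sw cr norm_swirl)
  ultimately have "((\<lambda>t. norm (V (X + t *\<^sub>R n))) \<longlongrightarrow> (0 * norm (E \<times> n)) powr (- \<alpha>)) (at_right 0)"
    using tendsto_cong by fast
  from tendsto_unique[OF _ 1 this] show ?thesis using EX by (simp add: swirl_def)
qed (rule sw)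

end

subsection \<open>The irrotational case\<close>

text \<open>If f is not zero, decay lets |f| attain a positive maximum, and the maximum modulus
  principle applies only near points where f attains it, away from the zeros.\<close>

lemma holomorphic_off_zeros_vanishing_at_infinity:
  fixes f :: "complex \<Rightarrow> complex"
  assumes cont: "continuous_on UNIV f"
    and diff: "\<And>z. f z \<noteq> 0 \<Longrightarrow> f field_differentiable at z"
    and lim: "(f \<longlongrightarrow> 0) at_infinity"
  shows "f z = 0"
proof (rule ccontr)
  assume fz: "f z \<noteq> 0"
  then obtain R where R: "\<And>w. norm w \<ge> R \<Longrightarrow> norm (f w) < norm (f z)"
    using tendstoD[OF lim, of "norm (f z)"] by (auto simp: eventually_at_infinity)
  have "norm z < R" using R[of z] by force
  then have R0: "R > 0" using norm_ge_zero order.strict_trans1 by blast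
  then have "cball (0::complex) R \<noteq> {}" by auto
  moreover have "continuous_on (cball 0 R) (\<lambda>w. norm (f w))"
    using cont continuous_on_norm continuous_on_subset by blast
  ultimately obtain w where w: "\<And>u. u \<in> cball 0 R \<Longrightarrow> norm (f u) \<le> norm (f w)"
    using continuous_attains_sup[OF compact_cball] by blast
  have max: "norm (f u) \<le> norm (f w)" for u
  proof (cases "norm u \<le> R")
    case False
    then show ?thesis using R[of u] w[of z] \<open>norm z < R\<close> by auto
  qed (simp add: w)
  have fw: "f w \<noteq> 0" using max[of z] fz by auto
  \<comment> \<open>Closed by continuity and open by the maximum modulus principle, so f would be
    constant.\<close>
  let ?S = "{u. f u = f w}"
  have "closed ?S" using cont by (intro closed_Collect_eq) auto
  moreover have "open ?S"
    unfolding open_contains_ball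
  proof
    fix u assume u: "u \<in> ?S"
    have "isCont f u" using cont by (simp add: continuous_on_eq_continuous_at)
    then obtain e where e: "e > 0" "\<And>y. dist u y < e \<Longrightarrow> f y \<noteq> 0"
      using continuous_at_avoid[of u f 0] u fw by auto
    have "f holomorphic_on ball u e"
      unfolding holomorphic_on_def
      by (intro ballI, rule field_differentiable_at_within, rule diff, rule e(2)) simp
    moreover have "norm (f y) \<le> norm (f u)" for y using max u by auto
    ultimately have "f constant_on ball u e"
      using e(1) by (intro maximum_modulus_principle[OF _ open_ball connected_ball open_ball order_refl, of f u e u]) simp_all
    then have "f y = f u" if "y \<in> ball u e" for y
      using that e(1) unfolding constant_on_def by (metis centre_in_ball)
    then have "ball u e \<subseteq> ?S" using u by (intro subsetI) (simp only: mem_Collect_eq)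
    then show "\<exists>e>0. ball u e \<subseteq> ?S" using e(1) by blast
  qed
  ultimately have "?S = {} \<or> ?S = UNIV" by (intro iffD1[OF clopen] conjI)
  moreover have "w \<in> ?S" by simp
  ultimately have "u \<in> ?S" for u by (metis UNIV_I empty_iff)
  \<comment> \<open>At the point R of the bounding circle |f| is below |f z|, which contradicts
    constancy.\<close>
  then have "f (of_real R) = f w" "f z = f w" by simp_all
  then show False using R[of "of_real R"] R0 by simp
qed

text \<open>Inverse stereographic projection, scaled so that it is polynomial.\<close>

definition stereo :: "complex \<Rightarrow> real^3"
  where "stereo z = vector [2 * Re z, 2 * Im z, (Re z)\<^sup>2 + (Im z)\<^sup>2 - 1]"

text \<open>Together with \<open>stereo_y\<close>, the partial derivatives of \<open>stereo\<close>
  in Re z and Im z.\<close>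

definition stereo_x :: "complex \<Rightarrow> real^3"
  where "stereo_x z = vector [2, 0, 2 * Re z]"

definition stereo_y :: "complex \<Rightarrow> real^3"
  where "stereo_y z = vector [0, 2, 2 * Im z]"

lemmas stereo_defs = stereo_def stereo_x_def stereo_y_def

lemma norm_stereo: "norm (stereo z) = 1 + (norm z)\<^sup>2"
proof -
  have "(norm (stereo z))\<^sup>2 = (1 + (norm z)\<^sup>2)\<^sup>2"
    unfolding power2_norm_eq_inner[of "stereo z"] cmod_power2
    by (simp add: inner_vec_def sum_3 stereo_def vector_3 power2_eq_square algebra_simps)
  then show ?thesis by (simp add: power2_eq_iff_nonneg)
qed

lemma stereo_nonzero: "stereo z \<noteq> 0"
  using norm_stereo[of z] by (metis norm_zero add_pos_nonneg zero_le_power2 zero_less_one less_irrefl)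

text \<open>Shows that a vector orthogonal to \<open>stereo z\<close> and both partial derivatives
  has vanishing third component.\<close>

lemma stereo_frame:
  "(1 + (norm z)\<^sup>2) *\<^sub>R axis 3 1 = Re z *\<^sub>R stereo_x z + Im z *\<^sub>R stereo_y z - stereo z"
  unfolding cmod_power2 vec_eq_iff forall_3
  by (simp add: axis_def stereo_defs vector_3 power2_eq_square)

text \<open>With S = \<open>stereo z\<close>, this pairs \<open>M\<close> with the matrix identity
  S_x S_x^T + S_y S_y^T = 4 I + 2 (S e_3^T + e_3 S^T). It reduces the divergence in the plane to the
  trace and radial terms.\<close>

lemma stereo_trace:
  "stereo_x z \<bullet> (M *v stereo_x z) + stereo_y z \<bullet> (M *v stereo_y z)
    = 4 * trace M + 2 * (stereo z \<bullet> (M *v axis 3 1) + axis 3 1 \<bullet> (M *v stereo z))"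
  unfolding inner_mv_sum
  by (simp add: trace_def sum_3 axis_def stereo_defs vector_3 power2_eq_square algebra_simps)

lemma stereo_deriv: "(stereo has_derivative (\<lambda>h. Re h *\<^sub>R stereo_x z + Im h *\<^sub>R stereo_y z)) (at z)"
proof -
  have eq: "stereo = (\<lambda>z. (2 * Re z) *\<^sub>R axis 1 1 + (2 * Im z) *\<^sub>R axis 2 1
      + ((Re z)\<^sup>2 + (Im z)\<^sup>2 - 1) *\<^sub>R axis 3 1)"
    by (simp add: fun_eq_iff vec_eq_iff forall_3 stereo_def vector_3 axis_def)
  show ?thesis unfolding eq
    by (auto intro!: derivative_eq_intros
        simp: fun_eq_iff vec_eq_iff forall_3 stereo_defs vector_3 axis_def)
qed

lemma stereo_x_deriv: "(stereo_x has_derivative (\<lambda>h. (2 * Re h) *\<^sub>R axis 3 1)) (at z)"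
proof -
  have eq: "stereo_x = (\<lambda>z. 2 *\<^sub>R axis 1 1 + (2 * Re z) *\<^sub>R axis 3 1)"
    by (simp add: fun_eq_iff vec_eq_iff forall_3 stereo_defs vector_3 axis_def)
  show ?thesis unfolding eq by (auto intro!: derivative_eq_intros)
qed

lemma stereo_y_deriv: "(stereo_y has_derivative (\<lambda>h. (2 * Im h) *\<^sub>R axis 3 1)) (at z)"
proof -
  have eq: "stereo_y = (\<lambda>z. 2 *\<^sub>R axis 2 1 + (2 * Im z) *\<^sub>R axis 3 1)"
    by (simp add: fun_eq_iff vec_eq_iff forall_3 stereo_defs vector_3 axis_def)
  show ?thesis unfolding eq by (auto intro!: derivative_eq_intros)
qed

section \<open>The flow with \<alpha> = 1 in stereographic coordinates\<close>

context homogeneous_tangential_flow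
begin

text \<open>The pullback of the one-form \<open>V \<cdot> dX\<close> along \<open>stereo\<close> is the real part of
  \<open>stereo_form z dz\<close>. For \<open>\<alpha> = 1\<close> it is closed and coclosed where \<open>V\<close> does not vanish, that is,
  \<open>stereo_form\<close> is holomorphic there.\<close>

definition stereo_form :: "complex \<Rightarrow> complex"
  where "stereo_form z = Complex (V (stereo z) \<bullet> stereo_x z) (- (V (stereo z) \<bullet> stereo_y z))"

lemma stereo_form_eq_0_iff: "stereo_form z = 0 \<longleftrightarrow> V (stereo z) = 0"
proof
  assume "stereo_form z = 0"
  then have x: "V (stereo z) \<bullet> stereo_x z = 0" and y: "V (stereo z) \<bullet> stereo_y z = 0"
    by (auto simp: stereo_form_def complex_eq_iff)
  have "(1 + (norm z)\<^sup>2) * (V (stereo z) \<bullet> axis 3 1) = V (stereo z) \<bullet> (Re z *\<^sub>R stereo_x z + Im z *\<^sub>R stereo_y z - stereo z)"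
    unfolding stereo_frame[symmetric] by simp
  also have "\<dots> = 0"
    using tangent[OF stereo_nonzero, of z] x y
    by (simp add: inner_diff_right inner_add_right inner_commute)
  finally have 3: "V (stereo z) $ 3 = 0"
    by (metis inner_axis inner_real_def mult_1_right mult_eq_0_iff add_pos_nonneg less_irrefl
        zero_le_power2 zero_less_one)
  have "V (stereo z) $ 1 = 0" using x 3 by (simp add: stereo_x_def inner_vec_def sum_3 vector_3)
  moreover have "V (stereo z) $ 2 = 0" using y 3 by (simp add: stereo_y_def inner_vec_def sum_3 vector_3)
  ultimately show "V (stereo z) = 0" using 3 by (simp add: vec_eq_iff forall_3)
qed (simp add: stereo_form_def complex_eq_iff)

text \<open>The skew part \<open>B\<close> of the Jacobian annihilates X and V X, which are
  independent; a skew form in three dimensions with such a kernel is zero.\<close>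

lemma DV_symmetric_if_alpha_1:
  assumes X: "X \<noteq> 0" and VX: "V X \<noteq> 0" and a: "\<alpha> = 1"
  shows "h \<bullet> (DV X *v k) = k \<bullet> (DV X *v h)"
proof -
  define w where "w = X \<times> V X"
  define d where "d = (X \<bullet> X) * (V X \<bullet> V X)"
  have d: "d \<noteq> 0" using X VX by (simp add: d_def)
  define B where "B h k = h \<bullet> (DV X *v k) - k \<bullet> (DV X *v h)" for h k
  have BX: "B h X = 0" for h
    using DV_radial[OF X] DV_tangent[OF X, of h] a by (simp add: B_def inner_commute)
  have BV: "B h (V X) = 0" for h
    using DV_gradient[OF X, of h] a by (simp add: B_def inner_commute)
  have red: "d * B h k = (k \<bullet> w) * B h w" for h k
  proof -
    have "d * B h k = B h (d *\<^sub>R k)"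
      by (simp add: B_def matrix_vector_mult_scaleR algebra_simps)
    also have "\<dots> = ((V X \<bullet> V X) * (k \<bullet> X)) * B h X + ((X \<bullet> X) * (k \<bullet> V X)) * B h (V X) + (k \<bullet> w) * B h w"
      unfolding d_def w_def frame_expansion[OF tangent[OF X], of k] B_def
      by (simp add: matrix_vector_right_distrib matrix_vector_mult_scaleR inner_add_left inner_add_right algebra_simps)
    finally show ?thesis by (simp add: BX BV)
  qed
  have "B h w = - B w h" by (simp add: B_def)
  moreover have "d * B w h = 0" unfolding red[of w h] by (simp add: B_def)
  ultimately have "B h k = 0" using red[of h k] d by simp
  then show ?thesis by (simp add: B_def)
qed

lemma stereo_form_differentiable:
  assumes a: "\<alpha> = 1" and fz: "stereo_form z \<noteq> 0"
  shows "stereo_form field_differentiable at z"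
proof -
  let ?M = "DV (stereo z)"
  have VS: "V (stereo z) \<noteq> 0" using fz stereo_form_eq_0_iff by blast
  \<comment> \<open>\<open>p\<close> is V paired with the second derivative of
    \<open>stereo\<close>, which is 2 e_3 in both Re z and Im z.\<close>
  define p A B C where "p = 2 * (V (stereo z) \<bullet> axis 3 1)"
    and "A = stereo_x z \<bullet> (?M *v stereo_x z)" and "B = stereo_x z \<bullet> (?M *v stereo_y z)" and "C = stereo_y z \<bullet> (?M *v stereo_y z)"
  have B': "stereo_y z \<bullet> (?M *v stereo_x z) = B"
    unfolding B_def by (rule DV_symmetric_if_alpha_1[OF stereo_nonzero VS a])
  \<comment> \<open>With \<open>B'\<close> this gives the Cauchy-Riemann equations:
    \<open>B'\<close> expresses vanishing curl, \<open>C\<close> vanishing divergence.\<close>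
  have C: "C = - A - 2 * p"
    using stereo_trace[of z ?M] DV_trace[OF stereo_nonzero, of z] DV_tangent[OF stereo_nonzero, of z "axis 3 1"]
      DV_radial[OF stereo_nonzero, of z] a
    by (simp add: p_def A_def C_def inner_commute)
  have VSd: "((\<lambda>z. V (stereo z)) has_derivative (\<lambda>h. ?M *v (Re h *\<^sub>R stereo_x z + Im h *\<^sub>R stereo_y z))) (at z)"
    by (rule has_derivative_compose[OF stereo_deriv V_deriv[OF stereo_nonzero]])
  from has_derivative_inner[OF VSd stereo_x_deriv]
  have x: "((\<lambda>z. V (stereo z) \<bullet> stereo_x z) has_derivative (\<lambda>h. (p + A) * Re h + B * Im h)) (at z)"
    unfolding matrix_vector_right_distrib matrix_vector_mult_scaleR inner_add_left
      inner_scaleR_left inner_scaleR_right inner_commute[of "?M *v _"] A_def[symmetric] B_def[symmetric]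
    by (rule has_derivative_eq_rhs) (simp add: p_def fun_eq_iff algebra_simps)
  from has_derivative_inner[OF VSd stereo_y_deriv]
  have y: "((\<lambda>z. V (stereo z) \<bullet> stereo_y z) has_derivative (\<lambda>h. B * Re h + (p + C) * Im h)) (at z)"
    unfolding matrix_vector_right_distrib matrix_vector_mult_scaleR inner_add_left
      inner_scaleR_left inner_scaleR_right inner_commute[of "?M *v _"] B' C_def[symmetric]
    by (rule has_derivative_eq_rhs) (simp add: p_def fun_eq_iff algebra_simps)
  have "(stereo_form has_derivative (\<lambda>h. Complex ((p + A) * Re h + B * Im h) (- (B * Re h + (p + C) * Im h)))) (at z)"
    unfolding stereo_form_def[abs_def] Complex_eq
    by (intro has_derivative_add has_derivative_of_real x has_derivative_mult_right
          has_derivative_minus y)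
  then have "(stereo_form has_derivative (\<lambda>h. Complex (p + A) (- B) * h)) (at z)"
    by (rule has_derivative_eq_rhs) (simp add: C fun_eq_iff complex_eq_iff algebra_simps)
  then show ?thesis
    unfolding field_differentiable_def has_field_derivative_def by blast
qed

text \<open>Homogeneity of degree -1 gives |V (stereo z)| = O(|z|^-2), while the partial derivatives
  of \<open>stereo\<close> grow like |z|.\<close>

lemma stereo_form_tendsto_0:
  assumes a: "\<alpha> = 1"
  shows "(stereo_form \<longlongrightarrow> 0) at_infinity"
proof -
  have "continuous_on (sphere 0 1) V"
    using V_cont by (intro continuous_at_imp_continuous_on) (metis norm_zero mem_sphere_0 zero_neq_one)
  then have "bounded (V ` sphere 0 1)"
    using compact_continuous_image compact_sphere compact_imp_bounded by blast
  then obtain K where "\<forall>Z\<in>V ` sphere 0 1. norm Z \<le> K"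
    unfolding bounded_iff by blast
  then have K: "norm (V X) \<le> K" if "X \<in> sphere 0 1" for X
    using that by blast
  have K0: "K \<ge> 0"
    using order_trans[OF norm_ge_zero K[of "axis 1 1"]] by (simp add: norm_axis_1)
  have bound: "norm (stereo_form z) \<le> 8 * K / norm z" if z: "norm z \<ge> 1" for z
  proof -
    have VS: "norm (V (stereo z)) \<le> K / (norm z)\<^sup>2"
    proof -
      have "V (stereo z) = V (norm (stereo z) *\<^sub>R sgn (stereo z))" using stereo_nonzero[of z] by (simp add: sgn_div_norm)
      also have "\<dots> = (1 / norm (stereo z)) *\<^sub>R V (sgn (stereo z))"
        using stereo_nonzero[of z] a by (subst V_scale) (auto simp: sgn_zero_iff powr_minus_divide)
      finally have "norm (V (stereo z)) = norm (V (sgn (stereo z))) / norm (stereo z)" by simp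
      also have "\<dots> \<le> K / (norm z)\<^sup>2"
        unfolding norm_stereo using K[of "sgn (stereo z)"] stereo_nonzero[of z] z K0
        by (intro frac_le) (auto simp: norm_sgn)
      finally show ?thesis .
    qed
    have "norm (stereo_x z) \<le> 4 * norm z"
      using norm_le_l1_cart[of "stereo_x z"] z abs_Re_le_cmod[of z]
      by (simp add: stereo_x_def sum_3 vector_3)
    moreover have "norm (stereo_y z) \<le> 4 * norm z"
      using norm_le_l1_cart[of "stereo_y z"] z abs_Im_le_cmod[of z]
      by (simp add: stereo_y_def sum_3 vector_3)
    moreover have "\<bar>V (stereo z) \<bullet> u\<bar> \<le> 4 * K / norm z" if "norm u \<le> 4 * norm z" for u
    proof -
      have "\<bar>V (stereo z) \<bullet> u\<bar> \<le> K / (norm z)\<^sup>2 * (4 * norm z)"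
        using Cauchy_Schwarz_ineq2[of "V (stereo z)" u] mult_mono[OF VS that] K0
        by (force intro: order_trans)
      moreover have "z \<noteq> 0" using z by auto
      ultimately show ?thesis by (simp add: power2_eq_square field_simps)
    qed
    ultimately have "\<bar>V (stereo z) \<bullet> stereo_x z\<bar> \<le> 4 * K / norm z" "\<bar>V (stereo z) \<bullet> stereo_y z\<bar> \<le> 4 * K / norm z" by blast+
    then show ?thesis using cmod_le[of "stereo_form z"] by (simp add: stereo_form_def)
  qed
  have "((\<lambda>z::complex. 8 * K / norm z) \<longlongrightarrow> 0) at_infinity"
    by (rule tendsto_divide_0[OF tendsto_const]) (simp add: filterlim_at_top_imp_at_infinity filterlim_norm_at_top)
  moreover have "\<forall>\<^sub>F z in at_infinity. norm (stereo_form z) \<le> 8 * K / norm z"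
    unfolding eventually_at_infinity using bound by blast
  ultimately show ?thesis by (rule Lim_null_comparison[rotated])
qed

lemma V_eq_0_if_alpha_1:
  assumes a: "\<alpha> = 1" and X: "X \<noteq> 0"
  shows "V X = 0"
proof -
  have "isCont stereo_form z" for z
    unfolding stereo_form_def[abs_def] Complex_eq
    by (intro continuous_intros isCont_o2[OF has_derivative_continuous[OF stereo_deriv]
          V_cont[OF stereo_nonzero]] has_derivative_continuous[OF stereo_x_deriv]
        has_derivative_continuous[OF stereo_y_deriv])
  then have "continuous_on UNIV stereo_form" by (simp add: continuous_at_imp_continuous_on)
  then have "stereo_form z = 0" for z
    by (rule holomorphic_off_zeros_vanishing_at_infinity[OF _ stereo_form_differentiable[OF a] stereo_form_tendsto_0[OF a]])
  then have VS: "V (stereo z) = 0" for z using stereo_form_eq_0_iff by blast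
  have n: "(norm X)\<^sup>2 = (X$1)\<^sup>2 + (X$2)\<^sup>2 + (X$3)\<^sup>2" for X :: "real^3"
    unfolding power2_norm_eq_inner[of X] by (simp add: inner_vec_def sum_3 power2_eq_square)
  have off_pole: "V X = 0" if X3: "X $ 3 < norm X" for X
  proof -
    \<comment> \<open>The stereographic preimage of the ray of X; \<open>c\<close> is the factor
      left over because \<open>stereo\<close> is not normalized to the sphere.\<close>
    define z where "z = Complex (X$1 / (norm X - X$3)) (X$2 / (norm X - X$3))"
    have "X \<noteq> 0" using X3 by auto
    define c where "c = 2 / (norm X - X$3)"
    have c: "c > 0" using X3 by (simp add: c_def)
    have "stereo z = c *\<^sub>R X"
    proof -
      have d: "norm X - X$3 \<noteq> 0" using X3 by simp
      have "((X$1)\<^sup>2 + (X$2)\<^sup>2) / (norm X - X$3)\<^sup>2 = ((norm X - X$3) * (norm X + X$3)) / (norm X - X$3)\<^sup>2"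
        using n[of X] by (simp add: algebra_simps power2_eq_square)
      also have "\<dots> = (norm X + X$3) / (norm X - X$3)" using d by (simp add: power2_eq_square)
      finally have "(X$1 / (norm X - X$3))\<^sup>2 + (X$2 / (norm X - X$3))\<^sup>2 - 1 = c * X$3"
        using d by (simp add: c_def power_divide field_simps)
      then show ?thesis
        unfolding vec_eq_iff forall_3 by (simp add: stereo_def vector_3 z_def c_def)
    qed
    then have "c powr (- \<alpha>) *\<^sub>R V X = 0" using VS[of z] V_scale[OF \<open>X \<noteq> 0\<close> c] by simp
    then show ?thesis using c by simp
  qed
  show ?thesis
  proof (rule ccontr)
    assume "V X \<noteq> 0"
    then obtain e where e: "e > 0" "\<And>Z. dist X Z < e \<Longrightarrow> V Z \<noteq> 0"
      using continuous_at_avoid[OF V_cont[OF X]] by blast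
    \<comment> \<open>The ray missed by \<open>stereo\<close> is handled by continuity: moving
      sideways from X leaves it, and V vanishes there.\<close>
    have pole: "X $ 3 = norm X"
      using off_pole[of X] \<open>V X \<noteq> 0\<close> component_le_norm_cart[of X 3] by fastforce
    define Z where "Z = X + (e / 2) *\<^sub>R axis 1 1"
    have "V Z \<noteq> 0" using e by (intro e(2)) (simp add: Z_def dist_norm norm_axis_1)
    have "V Z = 0"
    proof (rule off_pole)
      have "X $ 1 = 0" using n[of X] pole by simp
      then have "Z $ 1 \<noteq> 0" using e by (simp add: Z_def axis_def)
      then have "0 < (Z $ 1)\<^sup>2" by simp
      then have "(Z $ 3)\<^sup>2 < (norm Z)\<^sup>2" using n[of Z] zero_le_power2[of "Z $ 2"] by linarith
      then show "Z $ 3 < norm Z" using power2_less_imp_less norm_ge_zero by blast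
    qed
    then show False using \<open>V Z \<noteq> 0\<close> by simp
  qed
qed

end

subsection \<open>Classification\<close>

lemma C1_solution_imp_homogeneous_tangential_flow:
  assumes sol: "C1_solution \<alpha> v f p" and f: "\<forall>x\<in>sphere 0 1. f x = 0"
  shows "homogeneous_tangential_flow \<alpha> (homogeneous_velocity \<alpha> v f) (homogeneous_pressure \<alpha> p)"
proof
  fix X :: "real^3" and s :: real
  assume X: "X \<noteq> 0"
  have "v (sgn X) \<bullet> sgn X = 0" using sol X by (simp add: C1_solution_def norm_sgn)
  then have "X \<bullet> v (sgn X) = 0" using X by (simp add: sgn_div_norm inner_commute)
  moreover have "f (sgn X) = 0" using f X by (simp add: norm_sgn)
  ultimately show "X \<bullet> homogeneous_velocity \<alpha> v f X = 0" by (simp add: homogeneous_velocity_def)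
  assume s: "s > 0"
  have sgn: "sgn (s *\<^sub>R X) = sgn X" using s by (simp add: sgn_scaleR)
  show "homogeneous_velocity \<alpha> v f (s *\<^sub>R X) = s powr (- \<alpha>) *\<^sub>R homogeneous_velocity \<alpha> v f X"
    using s by (simp add: homogeneous_velocity_def sgn powr_mult powr_minus)
  show "homogeneous_pressure \<alpha> p (s *\<^sub>R X) = s powr (- (2 * \<alpha>)) * homogeneous_pressure \<alpha> p X"
    using s by (simp add: homogeneous_pressure_def sgn powr_mult powr_minus divide_inverse)
next
  show "stationary_euler_on (UNIV - {0}) (homogeneous_velocity \<alpha> v f) (homogeneous_pressure \<alpha> p)"
    using sol by (simp add: C1_solution_def)
qed

section \<open>Rotation to the third coordinate axis and the pressure\<close>

lemma axis_3_cross: "axis 3 1 \<times> X = vector [- (X$2), X$1, 0]"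
  by (simp add: vec_eq_iff forall_3 cross_components axis_def vector_3)

lemma norm_axis_3_cross: "norm (axis 3 1 \<times> X) = cyl_radius X"
  unfolding axis_3_cross norm_eq_sqrt_inner cyl_radius_def
  by (simp add: inner_vec_def sum_3 vector_3 power2_eq_square add.commute)

lemma cyl_radius_nonneg: "cyl_radius X \<ge> 0"
  by (simp add: cyl_radius_def)

lemma norm_rotation: "rotation_matrix Q \<Longrightarrow> norm (Q *v x) = norm (x :: real^'n)"
  using orthogonal_transformation_matrix[of "(*v) Q"] orthogonal_transformation_norm
  by (simp add: rotation_matrix_def)

text \<open>Rotations commute with the cross product. The length of E contributes e powr (-\<alpha>
  - 1) through the norm and e through the vector, hence the amplitude e powr (-\<alpha>).\<close>

lemma swirl_rotation:
  assumes Q: "rotation_matrix Q" and E: "E = e *\<^sub>R (Q *v axis 3 1)" and e: "e > 0"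
  shows "swirl \<alpha> E (Q *v X) = Q *v axial_velocity \<alpha> (e powr (- \<alpha>)) X"
    and "norm (E \<times> (Q *v X)) = e * cyl_radius X"
proof -
  have c: "E \<times> (Q *v X) = e *\<^sub>R (Q *v (axis 3 1 \<times> X))"
    unfolding E cross_mult_left cross_rotation_matrix[OF Q] ..
  show n: "norm (E \<times> (Q *v X)) = e * cyl_radius X"
    using e by (simp add: c norm_rotation[OF Q] norm_axis_3_cross)
  show "swirl \<alpha> E (Q *v X) = Q *v axial_velocity \<alpha> (e powr (- \<alpha>)) X"
  proof (cases "cyl_radius X = 0")
    case True
    then have "axis 3 1 \<times> X = 0" using norm_axis_3_cross[of X] by simp
    then show ?thesis by (simp add: swirl_def c axial_velocity_def flip: axis_3_cross)
  next
    case False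
    then have r: "cyl_radius X > 0" using cyl_radius_nonneg[of X] by simp
    have "swirl \<alpha> E (Q *v X) = ((e * cyl_radius X) powr (- \<alpha> - 1) * e) *\<^sub>R (Q *v (axis 3 1 \<times> X))"
      unfolding swirl_def n by (simp add: c)
    also have "(e * cyl_radius X) powr (- \<alpha> - 1) * e = e powr (- \<alpha>) / cyl_radius X powr (\<alpha> + 1)"
      using e r by (simp add: powr_mult powr_diff powr_add powr_minus_divide)
    finally show ?thesis by (simp add: axial_velocity_def axis_3_cross matrix_vector_mult_scaleR)
  qed
qed

lemma (in homogeneous_tangential_flow) nontrivial_classification:
  assumes X0: "X0 \<noteq> 0" "V X0 \<noteq> 0"
  shows "\<alpha> \<le> -1 \<and> (\<exists>(Q :: real^3^3) A. rotation_matrix Q \<and>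
      (\<forall>X. X \<noteq> 0 \<longrightarrow> V (Q *v X) = Q *v axial_velocity \<alpha> A X \<and>
         P (Q *v X) = axial_pressure \<alpha> A X))"
proof -
  have a: "\<alpha> \<noteq> 0" "\<alpha> \<noteq> 1" using V_eq_0_if_alpha_0 V_eq_0_if_alpha_1 X0 by auto
  obtain E where E: "E \<noteq> 0" and sw: "\<And>Z. E \<times> Z \<noteq> 0 \<Longrightarrow> V Z = swirl \<alpha> E Z"
    using globally_swirl[OF X0 a] by blast
  have V: "V Z = swirl \<alpha> E Z" if "Z \<noteq> 0" for Z by (rule swirl_on_axis[OF E sw that])
  define e where "e = norm E"
  have e: "e > 0" using E by (simp add: e_def)
  \<comment> \<open>The third axis is rotated to the oriented direction of E, so the sense of
    rotation is absorbed in \<open>Q\<close> and the amplitude is positive.\<close>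
  obtain Q where Q: "rotation_matrix Q" "Q *v axis 3 1 = E /\<^sub>R e"
    using rotation_matrix_exists_basis[of "E /\<^sub>R e" 3] e by (auto simp: e_def)
  have EQ: "E = e *\<^sub>R (Q *v axis 3 1)" using Q e by simp
  have "V (Q *v X) = Q *v axial_velocity \<alpha> (e powr (- \<alpha>)) X \<and>
      P (Q *v X) = axial_pressure \<alpha> (e powr (- \<alpha>)) X" if X: "X \<noteq> 0" for X
  proof -
    have QX: "Q *v X \<noteq> 0" using norm_rotation[OF Q(1), of X] X by auto
    have "norm (V (Q *v X)) = (e * cyl_radius X) powr (- \<alpha>)"
      by (simp add: V[OF QX] norm_swirl swirl_rotation(2)[OF Q(1) EQ e])
    then have "((e * cyl_radius X) powr (- \<alpha>))\<^sup>2 = - 2 * \<alpha> * P (Q *v X)"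
      using P_eq[OF QX] by (simp add: power2_norm_eq_inner flip: power2_norm_eq_inner)
    \<comment> \<open>On the axis both sides are 0 by the conventions for \<open>powr\<close> and
      division, so no separate case arises.\<close>
    moreover have "((e * cyl_radius X) powr (- \<alpha>))\<^sup>2 = (e powr (- \<alpha>))\<^sup>2 / cyl_radius X powr (2 * \<alpha>)"
    proof -
      have "(cyl_radius X powr (- \<alpha>))\<^sup>2 = cyl_radius X powr (- (2 * \<alpha>))"
        unfolding power2_eq_square powr_add[symmetric] by simp
      then show ?thesis
        using e cyl_radius_nonneg[of X]
        by (simp add: powr_mult power_mult_distrib powr_minus_divide[of _ "2 * \<alpha>"])
    qed
    ultimately have "(e powr (- \<alpha>))\<^sup>2 / cyl_radius X powr (2 * \<alpha>) = - 2 * \<alpha> * P (Q *v X)"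
      by simp
    then have "P (Q *v X) = - ((e powr (- \<alpha>))\<^sup>2 / cyl_radius X powr (2 * \<alpha>) / (2 * \<alpha>))"
      using a(1) by simp
    then have "P (Q *v X) = axial_pressure \<alpha> (e powr (- \<alpha>)) X"
      by (simp add: axial_pressure_def mult.commute)
    then show ?thesis using swirl_rotation(1)[OF Q(1) EQ e] V[OF QX] by simp
  qed
  then show ?thesis using swirl_imp_alpha_le[OF E sw] Q(1) by blast
qed

theorem proposition4p1:
  fixes \<alpha> :: real
  shows "(\<forall>v f p. C1_solution \<alpha> v f p \<and> (\<forall>x\<in>sphere 0 1. f x = 0) \<and>
            (\<exists>X. X \<noteq> 0 \<and> homogeneous_velocity \<alpha> v f X \<noteq> 0) \<longrightarrow>
            \<alpha> \<le> -1 \<and>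
            (\<exists>(Q :: real^3^3) A. rotation_matrix Q \<and>
               (\<forall>X. X \<noteq> 0 \<longrightarrow>
                  homogeneous_velocity \<alpha> v f (Q *v X) = Q *v axial_velocity \<alpha> A X \<and>
                  homogeneous_pressure \<alpha> p (Q *v X) = axial_pressure \<alpha> A X))) \<and>
         (\<alpha> > -1 \<longrightarrow>
            \<not> (\<exists>v f p. C1_solution \<alpha> v f p \<and> (\<forall>x\<in>sphere 0 1. f x = 0) \<and>
                  (\<exists>X. X \<noteq> 0 \<and> homogeneous_velocity \<alpha> v f X \<noteq> 0)))"
  (is "(\<forall>v f p. ?H v f p \<longrightarrow> ?C v f p) \<and> _")
proof -
  have main: "?C v f p" if H: "?H v f p" for v f p
  proof -
    from H obtain X where X: "X \<noteq> 0" "homogeneous_velocity \<alpha> v f X \<noteq> 0" by blast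
    from H have "homogeneous_tangential_flow \<alpha> (homogeneous_velocity \<alpha> v f) (homogeneous_pressure \<alpha> p)"
      using C1_solution_imp_homogeneous_tangential_flow by blast
    from homogeneous_tangential_flow.nontrivial_classification[OF this X] show ?thesis .
  qed
  then have "\<not> (\<alpha> > -1 \<and> (\<exists>v f p. ?H v f p))" by (meson not_le)
  with main show ?thesis by blast
qed

end
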